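(* Let $(E,d)$ be a complete metric space, let $F: E\to \mathbb{R}\cup\{\infty\}$ be a multivalued mapping with closed graph, let $c\in\mathbb{R}$, and let $U$ be a closed subset of $\mathrm{graph}\,F$. Let $\lambda>0$. Let $\varepsilon_0>0$ and $\delta>0$ be such that for every $(u,b)\in \{(u,b)\in E\times\mathbb{R} : b\in[c-2\varepsilon_0,c+2\varepsilon_0]\}\cap U_{2\delta}$ one has $|dF|(u,b)>\varepsilon_0$. Then there exists a continuous function $\eta=(\eta_1,\eta_2):[0,1]\times \mathrm{graph}\,F\to \mathrm{graph}\,F$ such that: (i) for every $t\in[0,1]$ and every $(u,b)\in\mathrm{graph}\,F$, $d_F\big(\eta(t,(u,b)),(u,b)\big)\le \lambda t$; (ii) for every $t\in[0,1]$ and every $(u,b)\in\mathrm{graph}\,F$, $\eta_2(t,(u,b))\le b$; (iii) if $(u,b)\in\mathrm{graph}\,F$ and $(u,b)\notin \{(u,b)\in E\times\mathbb{R} : b\in[c-2\varepsilon_0,c+2\varepsilon_0]\}\cap U_{2\delta}$, then $\eta(t,(u,b))=(u,b)$ for every $t\in[0,1]$; (iv) for some $\varepsilon'\in(0,\varepsilon_0)$, $\eta\big(1,\,U\cap (E\times(-\infty,c+\varepsilon'])\big)\subset E\times(-\infty,c-\varepsilon']$; (v) for every $t\in(0,1]$ and every $(u,b)\in (E\times(-\infty,c])\cap U$, $\eta_2(t,(u,b))<c$.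
   Context: A multivalued mapping $F:E\to\mathbb{R}\cup\{\infty\}$ assigns to each $u\in E$ a nonempty subset $F(u)$ of $\mathbb{R}\cup\{\infty\}$. Its graph is $\mathrm{graph}\,F=\{(u,c)\in E\times\mathbb{R} : c\in F(u)\}$; "$F$ has closed graph" means this set is closed in $E\times\mathbb{R}$. On $\mathrm{graph}\,F$ one uses the metric $d_F((u,c),(v,b))=\sqrt{d(u,v)^2+|b-c|^2}$, and $B((u,c),\delta)$ denotes the open ball in $(\mathrm{graph}\,F,d_F)$ with center $(u,c)$ and radius $\delta$. For a closed set $U\subset\mathrm{graph}\,F$ and $\delta>0$, $U_\delta=\{(u,b)\in\mathrm{graph}\,F : d_F((u,b),U)\le\delta\}$, where $d_F((u,b),U)$ is the distance from the point to the set. Weak slope: for $(u,c)\in\mathrm{graph}\,F$, $|dF|(u,c)\in[0,\infty]$ is the supremum of the $\sigma\in[0,\infty)$ such that there exist $\delta>0$ and a continuous function $\mathcal H=(\mathcal H_1,\mathcal H_2):B((u,c),\delta)\times[0,\delta]\to\mathrm{graph}\,F$ such that for every $(v,b)\in B((u,c),\delta)$ and every $t\in[0,\delta]$: (a) $d_F(\mathcal H((v,b),t),(v,b))\le t\sqrt{1+\sigma^2}$; (b) $\mathcal H_2((v,b),t)\le b-\sigma t$. *)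

theory Defs
  imports "HOL-Analysis.Analysis"
begin

text \<open>
  The metric \<open>d_F\<close> on the graph is the restriction of \<^term>\<open>dist\<close> on the product type
  \<^typ>\<open>'a \<times> real\<close>, which is by definition the square root of the sum of the squared distances
  of the components.
\<close>

definition multivalued :: "('a \<Rightarrow> ereal set) \<Rightarrow> bool" where
  "multivalued F \<longleftrightarrow> (\<forall>u. F u \<noteq> {} \<and> -\<infinity> \<notin> F u)"

definition mgraph :: "('a \<Rightarrow> ereal set) \<Rightarrow> ('a \<times> real) set" where
  "mgraph F = {(u, c). ereal c \<in> F u}"

definition gball :: "('a::metric_space \<Rightarrow> ereal set) \<Rightarrow> 'a \<times> real \<Rightarrow> real \<Rightarrow> ('a \<times> real) set" where
  "gball F p \<delta> = ball p \<delta> \<inter> mgraph F"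

text \<open>
  The distance to the empty set is \<open>\<infinity>\<close> here, whereas \<^term>\<open>infdist p {} = 0\<close>; hence the
  explicit nonemptiness condition.
\<close>

definition gnbhd :: "('a::metric_space \<Rightarrow> ereal set) \<Rightarrow> ('a \<times> real) set \<Rightarrow> real \<Rightarrow> ('a \<times> real) set" where
  "gnbhd F U \<delta> = {p \<in> mgraph F. U \<noteq> {} \<and> infdist p U \<le> \<delta>}"

definition slope_admissible :: "('a::metric_space \<Rightarrow> ereal set) \<Rightarrow> 'a \<times> real \<Rightarrow> real \<Rightarrow> bool" where
  "slope_admissible F p \<sigma> \<longleftrightarrow>
     (\<exists>\<delta>>0. \<exists>H :: ('a \<times> real) \<times> real \<Rightarrow> 'a \<times> real.
        continuous_on (gball F p \<delta> \<times> {0..\<delta>}) H \<and>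
        H ` (gball F p \<delta> \<times> {0..\<delta>}) \<subseteq> mgraph F \<and>
        (\<forall>q \<in> gball F p \<delta>. \<forall>t \<in> {0..\<delta>}.
           dist (H (q, t)) q \<le> t * sqrt (1 + \<sigma>\<^sup>2) \<and>
           snd (H (q, t)) \<le> snd q - \<sigma> * t))"

definition weak_slope :: "('a::metric_space \<Rightarrow> ereal set) \<Rightarrow> 'a \<times> real \<Rightarrow> ennreal" where
  "weak_slope F p = (SUP \<sigma> \<in> {\<sigma>. 0 \<le> \<sigma> \<and> slope_admissible F p \<sigma>}. ennreal \<sigma>)"

definition strip :: "real \<Rightarrow> real \<Rightarrow> ('a \<times> real) set" where
  "strip c \<epsilon> = UNIV \<times> {c - \<epsilon>..c + \<epsilon>}"

end

theory Submission
  imports Defs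
begin

text \<open>
  Write \<open>X\<close> for the graph of \<open>F\<close>, a complete metric space, and \<open>f = snd\<close> for its height function,
  which is 1-Lipschitz. Let \<open>K\<close> be the part of the strip around level \<open>c\<close> on which the weak slope
  is known to exceed \<open>\<epsilon>0\<close>. After a change of time scale, every point of \<open>K\<close> has a ball that can be
  deformed so that by time \<open>t\<close> points are displaced by at most \<open>t\<close> and \<open>f\<close> has dropped by at least
  \<open>\<kappa> * t\<close>, where \<open>\<kappa> = \<epsilon>0 / sqrt (1 + \<epsilon>0\<^sup>2)\<close> (\<open>weak_slope_local_descent\<close>). These local
  deformations are combined into one global flow.

  The flow is built on pairs \<open>(q, r)\<close> of a point and a remaining budget of displacement. A step moves
  \<open>q\<close>, pays out of \<open>r\<close> at least the distance moved, and lowers \<open>f\<close> by at least \<open>\<kappa>\<close> times the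
  payment; this property is stable under composition. Any open cover of a metric space has an open
  refinement that splits into countably many disjoint families
  (\<open>sigma_disjoint_open_refinement\<close>). Within one disjoint family the local deformations do not
  interfere, so each family yields one continuous step, which pays something at every point that the
  family covers, as long as any budget is left (\<open>glue_local_descents\<close>).

  Apply the resulting countably many steps one after the other, each of them infinitely often. The
  points move by at most the decrease of the budget, so by completeness they converge. If a positive
  budget were left at a limit point in \<open>K\<close>, some step would pay a fixed positive amount near that
  limit, infinitely often, which is impossible. Hence the budget is used up completely as soon as the
  ball of radius \<open>r\<close> around \<open>q\<close> stays in \<open>K\<close>. Exhaustion of the budget is also what makes the limit
  map \<open>\<Theta>\<close> continuous: after finitely many steps the rest of the motion is bounded by the budget left,
  and that is small on a whole neighbourhood (\<open>budgeted_flow\<close>).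

  Finally the deformation is \<open>\<eta> (t, p) = \<Theta> (p, t * g p)\<close>, where the budget \<open>g p \<le> l\<close> is continuous,
  vanishes off \<open>K\<close>, keeps the ball around \<open>p\<close> inside \<open>K\<close>, and is bounded below by a positive
  constant on the points of \<open>U\<close> whose height is within \<open>\<epsilon>0\<close> of \<open>c\<close>.
\<close>

section \<open>Steps that pay for motion and descent\<close>

text \<open>
  The state \<open>(q, r)\<close> carries the displacement \<open>r\<close> that may still be spent. Measuring progress by the
  payment \<open>snd z - snd (S z)\<close> rather than by time lets steps of different durations be composed
  without bookkeeping.
\<close>
definition budget_step :: "'b::metric_space set \<Rightarrow> ('b \<Rightarrow> real) \<Rightarrow> real \<Rightarrow> ('b \<times> real \<Rightarrow> 'b \<times> real) \<Rightarrow> bool" where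
  "budget_step X f \<kappa> S \<longleftrightarrow>
     continuous_on (X \<times> {0..}) S \<and> S ` (X \<times> {0..}) \<subseteq> X \<times> {0..} \<and>
     (\<forall>z \<in> X \<times> {0..}. dist (fst (S z)) (fst z) \<le> snd z - snd (S z) \<and>
        f (fst (S z)) \<le> f (fst z) - \<kappa> * (snd z - snd (S z)))"

text \<open>
  The deformations in the definition of the weak slope, on the time scale on which the displacement
  is at most \<open>t\<close> instead of \<open>t * sqrt (1 + \<sigma>\<^sup>2)\<close>.
\<close>
definition local_descent ::
  "'b::metric_space set \<Rightarrow> ('b \<Rightarrow> real) \<Rightarrow> real \<Rightarrow> 'b set \<Rightarrow> real \<Rightarrow> ('b \<times> real \<Rightarrow> 'b) \<Rightarrow> bool" where
  "local_descent X f \<kappa> V \<rho> h \<longleftrightarrow>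
     continuous_on ((X \<inter> V) \<times> {0..\<rho>}) h \<and> h ` ((X \<inter> V) \<times> {0..\<rho>}) \<subseteq> X \<and>
     (\<forall>q \<in> X \<inter> V. \<forall>t \<in> {0..\<rho>}. dist (h (q, t)) q \<le> t \<and> f (h (q, t)) \<le> f q - \<kappa> * t)"

lemma budget_stepD:
  assumes "budget_step X f \<kappa> S" "z \<in> X \<times> {0..}"
  shows "S z \<in> X \<times> {0..}" "dist (fst (S z)) (fst z) \<le> snd z - snd (S z)"
    "f (fst (S z)) \<le> f (fst z) - \<kappa> * (snd z - snd (S z))"
  using assms by (auto simp: budget_step_def)

section \<open>Disjoint families of open sets\<close>

text \<open>
  This is the separation step of M. E. Rudin's proof that metric spaces are paracompact. Well-order
  the index set, and at scale \<open>1 / 2 ^ n\<close> keep for the index \<open>i\<close> only points that lie in no earlier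
  \<open>B j\<close> and deep inside \<open>B i\<close>. For two different indices such points are at least \<open>3 / 2 ^ n\<close> apart,
  so balls of radius \<open>1 / 2 ^ n\<close> around them are disjoint. A given point is caught by the first
  \<open>B i\<close> that contains it, once \<open>n\<close> is large.
\<close>
lemma sigma_disjoint_open_refinement:
  fixes B :: "'i \<Rightarrow> 'b::metric_space set"
  assumes opn: "\<And>i. i \<in> I \<Longrightarrow> open (B i)"
  shows "\<exists>V :: nat \<Rightarrow> 'i \<Rightarrow> 'b set. (\<forall>n. \<forall>i\<in>I. open (V n i) \<and> V n i \<subseteq> B i) \<and>
           (\<forall>n. disjoint_family_on (V n) I) \<and> (\<Union>n. \<Union>i\<in>I. V n i) = (\<Union>i\<in>I. B i)"
proof -
  obtain R :: "'i rel" where "Well_order R" and "Field R = UNIV"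
    using well_ordering[where 'a = 'i] by auto
  then have wf: "wf (R - Id)" and tot: "\<And>i j. i \<noteq> j \<Longrightarrow> (i, j) \<in> R \<or> (j, i) \<in> R"
    by (auto simp: well_order_on_def linear_order_on_def total_on_def)
  define C where "C n i = {x. ball x (3 / 2 ^ n) \<subseteq> B i \<and> (\<forall>j\<in>I. (j, i) \<in> R - Id \<longrightarrow> x \<notin> B j)}" for n :: nat and i
  define V where "V n i = (\<Union>x\<in>C n i. ball x (1 / 2 ^ n))" for n :: nat and i
  have sub: "V n i \<subseteq> B i" for n i
  proof -
    have "ball x (1 / 2 ^ n) \<subseteq> ball x (3 / 2 ^ n)" for x :: 'b
      by (intro subset_ball divide_right_mono) auto
    then show ?thesis unfolding V_def C_def by blast
  qed
  have op: "open (V n i)" for n i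
    unfolding V_def by auto
  have sep: "V n i \<inter> V n j = {}" if ij: "(i, j) \<in> R - Id" "i \<in> I" for n i j
  proof (rule ccontr)
    assume "V n i \<inter> V n j \<noteq> {}"
    then obtain z where "z \<in> V n i" "z \<in> V n j" by blast
    then obtain x y where x: "x \<in> C n i" and y: "y \<in> C n j"
      and z: "dist x z < 1 / 2 ^ n" "dist y z < 1 / 2 ^ n"
      unfolding V_def by auto
    have "dist x y < 2 / 2 ^ n"
      using z dist_triangle2[of x y z] by simp
    also have "(2::real) / 2 ^ n \<le> 3 / 2 ^ n"
      by (intro divide_right_mono) auto
    finally have "y \<in> B i"
      using x unfolding C_def by (auto simp: subset_iff)
    with y ij show False unfolding C_def by auto
  qed
  have disj: "disjoint_family_on (V n) I" for n
    unfolding disjoint_family_on_def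
  proof (intro ballI impI)
    fix i j assume "i \<in> I" "j \<in> I" "i \<noteq> j"
    with tot[of i j] sep[of i j n] sep[of j i n] show "V n i \<inter> V n j = {}"
      by blast
  qed
  have "x \<in> (\<Union>n. \<Union>i\<in>I. V n i)" if iB: "i \<in> I" "x \<in> B i" for x i
  proof -
    obtain m where m: "m \<in> {i\<in>I. x \<in> B i}" and "\<And>j. (j, m) \<in> R - Id \<Longrightarrow> j \<notin> {i\<in>I. x \<in> B i}"
      using wfE_min[OF wf, of i "{i\<in>I. x \<in> B i}"] iB by blast
    then have min: "\<forall>j\<in>I. (j, m) \<in> R - Id \<longrightarrow> x \<notin> B j" by blast
    obtain e where e: "e > 0" "ball x e \<subseteq> B m"
      using opn m open_contains_ball by blast
    obtain n where n: "(1/2) ^ n < e / 3"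
      using real_arch_pow_inv[of "e/3" "1/2"] e by auto
    then have "3 / 2 ^ n \<le> e"
      by (simp add: power_one_over field_simps)
    then have "ball x (3 / 2 ^ n) \<subseteq> B m"
      using e subset_ball by blast
    with min have "x \<in> C n m" unfolding C_def by auto
    then have "x \<in> V n m" unfolding V_def by force
    with m show ?thesis by blast
  qed
  then have "(\<Union>n. \<Union>i\<in>I. V n i) = (\<Union>i\<in>I. B i)"
    using sub by blast
  with op sub disj show ?thesis
    by (intro exI[of _ V]) simp
qed

text \<open>
  On \<open>V i\<close> take the distance to the complement, truncated at \<open>\<rho> i\<close>. Disjointness lets these functions be united
  into one. The union is continuous at a point \<open>p\<close> outside every \<open>V i\<close> because all of them are bounded
  by the distance to \<open>p\<close>.
\<close>
lemma disjoint_open_cutoff: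
  fixes V :: "'i \<Rightarrow> 'b::metric_space set"
  assumes opn: "\<And>i. i \<in> I \<Longrightarrow> open (V i)" and disj: "disjoint_family_on V I"
    and \<rho>: "\<And>i. i \<in> I \<Longrightarrow> \<rho> i > 0"
  obtains \<tau> :: "'b \<Rightarrow> real" where "continuous_on UNIV \<tau>" "\<And>q. 0 \<le> \<tau> q"
    "\<And>i q. i \<in> I \<Longrightarrow> q \<in> V i \<Longrightarrow> 0 < \<tau> q \<and> \<tau> q \<le> \<rho> i" "\<And>q. q \<notin> (\<Union>i\<in>I. V i) \<Longrightarrow> \<tau> q = 0"
proof -
  \<comment> \<open>If \<open>V i\<close> is the whole space, the distance to its complement is 0 by convention, which would
    destroy positivity.\<close>
  define w where "w i q = (if V i = UNIV then \<rho> i else min (\<rho> i) (infdist q (- V i)))" for i q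
  have w_cont: "continuous_on UNIV (w i)" for i
    unfolding w_def by (cases "V i = UNIV") (auto intro!: continuous_intros)
  have w_pos: "0 < w i q \<and> w i q \<le> \<rho> i" if "i \<in> I" "q \<in> V i" for i q
  proof -
    have "infdist q (- V i) > 0" if "V i \<noteq> UNIV"
      using in_closed_iff_infdist_zero[of "- V i" q] opn[OF \<open>i \<in> I\<close>] \<open>q \<in> V i\<close> that
        infdist_nonneg[of q "- V i"]
      by (fastforce simp: closed_def)
    then show ?thesis using \<rho>[OF \<open>i \<in> I\<close>] unfolding w_def by auto
  qed
  have w_le: "w i q \<le> dist q p" if "p \<notin> V i" for i p q
    using that infdist_le[of p "- V i" q] unfolding w_def by auto
  define \<tau> where "\<tau> q = (if q \<in> (\<Union>i\<in>I. V i) then w (SOME i. i \<in> I \<and> q \<in> V i) q else 0)" for q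
  have \<tau>_eq: "\<tau> q = w i q" if "i \<in> I" "q \<in> V i" for i q
  proof -
    have "(SOME i. i \<in> I \<and> q \<in> V i) = i"
      using that disj by (intro some_equality) (auto simp: disjoint_family_on_def)
    with that show ?thesis unfolding \<tau>_def by auto
  qed
  have \<tau>_0: "\<tau> q = 0" if "q \<notin> (\<Union>i\<in>I. V i)" for q
    using that unfolding \<tau>_def by auto
  have \<tau>_nonneg: "0 \<le> \<tau> q" for q
    using w_pos by (cases "q \<in> (\<Union>i\<in>I. V i)") (auto simp: \<tau>_0 \<tau>_eq less_imp_le)
  have "isCont \<tau> p" for p
  proof (cases "p \<in> (\<Union>i\<in>I. V i)")
    case True
    then obtain i where i: "i \<in> I" "p \<in> V i" by auto
    have "isCont (w i) p"
      using w_cont[of i] by (simp add: continuous_on_eq_continuous_at)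
    moreover have "eventually (\<lambda>q. \<tau> q = w i q) (nhds p)"
      using eventually_nhds_in_open[OF opn[OF i(1)] i(2)] by eventually_elim (auto simp: \<tau>_eq i)
    ultimately show ?thesis
      by (simp add: isCont_cong)
  next
    case False
    have "\<tau> q \<le> dist q p" for q
      using False w_le by (cases "q \<in> (\<Union>i\<in>I. V i)") (auto simp: \<tau>_0 \<tau>_eq)
    moreover have "((\<lambda>q. dist q p) \<longlongrightarrow> 0) (at p)"
      by (rule tendsto_eq_intros refl | simp)+
    ultimately have "(\<tau> \<longlongrightarrow> 0) (at p)"
      using \<tau>_nonneg by (intro tendsto_sandwich[of "\<lambda>_. 0" \<tau> "at p" "\<lambda>q. dist q p"]) auto
    with False show ?thesis
      by (simp add: isCont_def \<tau>_0)
  qed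
  then have "continuous_on UNIV \<tau>"
    by (simp add: continuous_on_eq_continuous_at)
  with \<tau>_nonneg \<tau>_0 \<tau>_eq w_pos show ?thesis
    by (intro that[of \<tau>]) auto
qed

text \<open>
  On \<open>V i\<close> follow the \<open>i\<close>-th local deformation for the time allowed by both the budget and a cutoff
  that tends to 0 at the boundary of \<open>V i\<close>; elsewhere stay put. The displacement is at most the
  cutoff, so the glued map remains continuous where the families end.
\<close>
lemma glue_local_descents:
  fixes V :: "'i \<Rightarrow> 'b::metric_space set"
  assumes opn: "\<And>i. i \<in> I \<Longrightarrow> open (V i)" and disj: "disjoint_family_on V I"
    and \<rho>: "\<And>i. i \<in> I \<Longrightarrow> \<rho> i > 0"
    and loc: "\<And>i. i \<in> I \<Longrightarrow> local_descent X f \<kappa> (V i) (\<rho> i) (h i)"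
  shows "\<exists>S. budget_step X f \<kappa> S \<and> (\<forall>q \<in> X \<inter> (\<Union>i\<in>I. V i). \<forall>r>0. snd (S (q, r)) < r)"
proof -
  obtain \<tau> :: "'b \<Rightarrow> real" where \<tau>_cont: "continuous_on UNIV \<tau>" and \<tau>_nonneg: "\<And>q. 0 \<le> \<tau> q"
    and \<tau>_pos: "\<And>i q. i \<in> I \<Longrightarrow> q \<in> V i \<Longrightarrow> 0 < \<tau> q \<and> \<tau> q \<le> \<rho> i"
    and \<tau>_0: "\<And>q. q \<notin> (\<Union>i\<in>I. V i) \<Longrightarrow> \<tau> q = 0"
    by (rule disjoint_open_cutoff[OF opn disj \<rho>]) auto
  define H where "H q t = (if q \<in> (\<Union>i\<in>I. V i) then h (SOME i. i \<in> I \<and> q \<in> V i) (q, t) else q)" for q t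
  have H_eq: "H q t = h i (q, t)" if "i \<in> I" "q \<in> V i" for i q t
  proof -
    have "(SOME i. i \<in> I \<and> q \<in> V i) = i"
      using that disj by (intro some_equality) (auto simp: disjoint_family_on_def)
    with that show ?thesis unfolding H_def by auto
  qed
  have H_0: "H q t = q" if "q \<notin> (\<Union>i\<in>I. V i)" for q t
    using that unfolding H_def by auto
  define m where "m z = min (snd z) (\<tau> (fst z))" for z :: "'b \<times> real"
  define S where "S z = (H (fst z) (m z), snd z - m z)" for z
  have m_cont: "continuous_on A m" for A
    unfolding m_def by (auto intro!: continuous_intros continuous_on_compose2[OF \<tau>_cont])
  have H_props: "H q t \<in> X \<and> dist (H q t) q \<le> t \<and> f (H q t) \<le> f q - \<kappa> * t"
    if "q \<in> X" "0 \<le> t" "t \<le> \<tau> q" for q t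
  proof (cases "q \<in> (\<Union>i\<in>I. V i)")
    case True
    then obtain i where i: "i \<in> I" "q \<in> V i" by auto
    with \<tau>_pos[OF i] that have "q \<in> X \<inter> V i" "t \<in> {0..\<rho> i}" by auto
    with loc[OF i(1)] show ?thesis
      unfolding local_descent_def H_eq[OF i] by blast
  next
    case False
    with that \<tau>_0[of q] show ?thesis by (simp add: H_0)
  qed
  have m_range: "0 \<le> m z \<and> m z \<le> \<tau> (fst z) \<and> m z \<le> snd z" if "z \<in> X \<times> {0..}" for z
    using that \<tau>_nonneg unfolding m_def by auto
  have H_cont: "continuous_on (X \<times> {0..}) (\<lambda>z. H (fst z) (m z))"
    unfolding continuous_on_eq_continuous_within
  proof
    fix z assume z: "z \<in> X \<times> {0::real..}"
    show "continuous (at z within X \<times> {0..}) (\<lambda>z. H (fst z) (m z))"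
    proof (cases "fst z \<in> (\<Union>i\<in>I. V i)")
      case True
      then obtain i where i: "i \<in> I" "fst z \<in> V i" by auto
      let ?A = "(X \<inter> V i) \<times> {0::real..}"
      have "continuous_on ?A (\<lambda>z. h i (fst z, m z))"
      proof (rule continuous_on_compose2[where g = "h i" and f = "\<lambda>z. (fst z, m z)"])
        show "continuous_on ((X \<inter> V i) \<times> {0..\<rho> i}) (h i)"
          using loc[OF i(1)] unfolding local_descent_def by blast
        show "continuous_on ?A (\<lambda>z. (fst z, m z))"
          by (intro continuous_intros m_cont)
        show "(\<lambda>z. (fst z, m z)) ` ?A \<subseteq> (X \<inter> V i) \<times> {0..\<rho> i}"
          using m_range \<tau>_pos[OF i(1)] by fastforce
      qed
      then have "continuous_on ?A (\<lambda>z. H (fst z) (m z))"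
        by (rule continuous_on_eq) (auto simp: H_eq[OF i(1)])
      then have "continuous (at z within ?A) (\<lambda>z. H (fst z) (m z))"
        using z i by (auto simp: continuous_on_eq_continuous_within)
      moreover have "at z within ?A = at z within X \<times> {0..}"
        by (rule at_within_nhd[of z "V i \<times> UNIV"]) (use i opn[OF i(1)] in \<open>auto simp: mem_Times_iff intro!: open_Times\<close>)
      ultimately show ?thesis by simp
    next
      case False
      have "((\<lambda>y. dist (H (fst y) (m y)) (fst z)) \<longlongrightarrow> 0) (at z within X \<times> {0..})"
      proof (rule tendsto_sandwich[where f = "\<lambda>_. 0"])
        show "\<forall>\<^sub>F y in at z within X \<times> {0..}.
            dist (H (fst y) (m y)) (fst z) \<le> \<tau> (fst y) + dist (fst y) (fst z)"
          unfolding eventually_at_filter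
        proof (rule always_eventually, intro allI impI)
          fix y assume y: "y \<in> X \<times> {0::real..}"
          then have "dist (H (fst y) (m y)) (fst y) \<le> m y"
            using H_props m_range[OF y] by auto
          with m_range[OF y] dist_triangle[of "H (fst y) (m y)" "fst z" "fst y"]
          show "dist (H (fst y) (m y)) (fst z) \<le> \<tau> (fst y) + dist (fst y) (fst z)"
            by linarith
        qed
        have "((\<lambda>y. \<tau> (fst y) + dist (fst y) (fst z)) \<longlongrightarrow> \<tau> (fst z) + dist (fst z) (fst z))
            (at z within X \<times> {0..})"
          by (intro tendsto_intros continuous_on_tendsto_compose[OF \<tau>_cont]) auto
        then show "((\<lambda>y. \<tau> (fst y) + dist (fst y) (fst z)) \<longlongrightarrow> 0) (at z within X \<times> {0..})"
          using \<tau>_0[OF False] by simp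
      qed auto
      then show ?thesis
        using tendsto_dist_iff[of "\<lambda>y. H (fst y) (m y)" "fst z"] False
        by (simp add: continuous_within H_0)
    qed
  qed
  have "budget_step X f \<kappa> S"
    unfolding budget_step_def
  proof (intro conjI ballI)
    show "continuous_on (X \<times> {0..}) S"
      unfolding S_def by (intro continuous_intros H_cont m_cont)
    show "S ` (X \<times> {0..}) \<subseteq> X \<times> {0..}"
      using m_range H_props unfolding S_def by fastforce
    fix z assume z: "z \<in> X \<times> {0::real..}"
    with m_range[OF z] H_props[of "fst z" "m z"]
    show "dist (fst (S z)) (fst z) \<le> snd z - snd (S z)"
      "f (fst (S z)) \<le> f (fst z) - \<kappa> * (snd z - snd (S z))"
      unfolding S_def by auto
  qed
  moreover have "snd (S (q, r)) < r" if "q \<in> X \<inter> (\<Union>i\<in>I. V i)" "r > 0" for q r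
    using that \<tau>_pos unfolding S_def m_def by force
  ultimately show ?thesis by blast
qed

section \<open>Infinite iteration\<close>

text \<open>
  The first component of \<open>prod_decode k\<close> takes every value infinitely often, so every step \<open>S n\<close> is
  scheduled infinitely often.
\<close>
primrec run :: "(nat \<Rightarrow> 'c \<Rightarrow> 'c) \<Rightarrow> nat \<Rightarrow> 'c \<Rightarrow> 'c" where
  "run S 0 z = z"
| "run S (Suc k) z = S (fst (prod_decode k)) (run S k z)"

text \<open>
  Along the times at which \<open>S n\<close> is scheduled, the state before and the state after the step both
  tend to \<open>z'\<close>. Applied with the budget as \<open>g\<close>, this says that no step can make progress at a limit
  of the iteration.
\<close>
lemma run_progress:
  fixes S :: "nat \<Rightarrow> 'c::topological_space \<Rightarrow> 'c" and g :: "'c \<Rightarrow> real"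
  assumes S: "continuous_on A (S n)" and g: "continuous_on UNIV g"
    and run: "\<And>k. run S k z \<in> A" and z': "z' \<in> A" and lim: "(\<lambda>k. run S k z) \<longlonglongrightarrow> z'"
  shows "g (S n z') = g z'"
proof -
  have step: "run S (Suc (prod_encode (n, j))) z = S n (run S (prod_encode (n, j)) z)" for j
    by simp
  have "filterlim (\<lambda>j. prod_encode (n, j)) sequentially sequentially"
    by (rule filterlim_at_top_mono[OF filterlim_ident]) (simp add: le_prod_encode_2)
  then have sub: "(\<lambda>j. run S (prod_encode (n, j)) z) \<longlonglongrightarrow> z'"
      "(\<lambda>j. run S (Suc (prod_encode (n, j))) z) \<longlonglongrightarrow> z'"
    using lim filterlim_compose LIMSEQ_Suc by blast+
  have g_lim: "(\<lambda>j. g (y j)) \<longlonglongrightarrow> g y'" if "y \<longlonglongrightarrow> y'" for y y'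
    using continuous_on_tendsto_compose[OF g that] by simp
  have "(\<lambda>j. S n (run S (prod_encode (n, j)) z)) \<longlonglongrightarrow> S n z'"
    using continuous_on_tendsto_compose[OF S sub(1) z'] run by simp
  then have "(\<lambda>j. g (run S (Suc (prod_encode (n, j))) z)) \<longlonglongrightarrow> g (S n z')"
    unfolding step by (rule g_lim)
  with g_lim[OF sub(2)] show ?thesis
    using LIMSEQ_unique by blast
qed

lemma budget_step_compose:
  assumes S: "budget_step X f \<kappa> S" and T: "budget_step X f \<kappa> T"
  shows "budget_step X f \<kappa> (\<lambda>z. T (S z))"
  unfolding budget_step_def
proof (intro conjI ballI)
  have S': "S ` (X \<times> {0..}) \<subseteq> X \<times> {0..}" using S unfolding budget_step_def by blast
  show "continuous_on (X \<times> {0..}) (\<lambda>z. T (S z))"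
    by (rule continuous_on_compose2[OF _ _ S']) (use S T in \<open>simp_all add: budget_step_def\<close>)
  show "(\<lambda>z. T (S z)) ` (X \<times> {0..}) \<subseteq> X \<times> {0..}"
    using budget_stepD(1)[OF S] budget_stepD(1)[OF T] by blast
  fix z assume z: "z \<in> X \<times> {0::real..}"
  then have Sz: "S z \<in> X \<times> {0..}" using S' by blast
  have 1: "dist (fst (S z)) (fst z) \<le> snd z - snd (S z)"
    "f (fst (S z)) \<le> f (fst z) - \<kappa> * (snd z - snd (S z))"
    using budget_stepD[OF S z] by auto
  have 2: "dist (fst (T (S z))) (fst (S z)) \<le> snd (S z) - snd (T (S z))"
    "f (fst (T (S z))) \<le> f (fst (S z)) - \<kappa> * (snd (S z) - snd (T (S z)))"
    using budget_stepD[OF T Sz] by auto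
  show "dist (fst (T (S z))) (fst z) \<le> snd z - snd (T (S z))"
    using 1 2 dist_triangle[of "fst (T (S z))" "fst z" "fst (S z)"] by linarith
  show "f (fst (T (S z))) \<le> f (fst z) - \<kappa> * (snd z - snd (T (S z)))"
    using 1 2 by (simp add: algebra_simps)
qed

lemma budget_step_run:
  assumes "\<And>n. budget_step X f \<kappa> (S n)"
  shows "budget_step X f \<kappa> (run S k)"
proof (induction k)
  case 0
  show ?case by (auto simp: budget_step_def cong: continuous_on_cong)
next
  case (Suc k)
  with assms show ?case
    using budget_step_compose[OF Suc assms[of "fst (prod_decode k)"]] by simp
qed

text \<open>
  On the set \<open>D\<close> the whole budget is spent, because the limit point stays in \<open>K\<close>, where some step
  would still make progress. The pairs with \<open>r = 0\<close> belong to \<open>D\<close> for every point of \<open>X\<close>: a point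
  without budget does not move. Including them is what later permits a budget that vanishes off \<open>K\<close>.
\<close>
lemma budgeted_flow:
  fixes X :: "'b::complete_space set" and f :: "'b \<Rightarrow> real"
    and S :: "nat \<Rightarrow> 'b \<times> real \<Rightarrow> 'b \<times> real"
  assumes X: "closed X" and f: "continuous_on X f"
    and S: "\<And>n. budget_step X f \<kappa> (S n)"
    and progress: "\<And>q r. q \<in> X \<inter> K \<Longrightarrow> r > 0 \<Longrightarrow> \<exists>n. snd (S n (q, r)) < r"
  defines "D \<equiv> {(q, r). q \<in> X \<and> 0 \<le> r \<and> (r = 0 \<or> X \<inter> cball q r \<subseteq> K)}"
  shows "\<exists>\<Theta>. continuous_on D \<Theta> \<and>
           (\<forall>(q, r) \<in> D. \<Theta> (q, r) \<in> X \<and> dist (\<Theta> (q, r)) q \<le> r \<and> f (\<Theta> (q, r)) \<le> f q - \<kappa> * r)"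
proof -
  define Q where "Q k = (\<lambda>z. fst (run S k z))" for k
  define R where "R k = (\<lambda>z. snd (run S k z))" for k
  note defs = Q_def R_def
  have DX: "D \<subseteq> X \<times> {0..}" unfolding D_def by auto
  have run: "budget_step X f \<kappa> (run S k)" for k
    using S by (rule budget_step_run)
  have run_cont: "continuous_on D (run S k)" for k
    using run DX unfolding budget_step_def by (meson continuous_on_subset)
  have Q_cont: "continuous_on D (Q k)" and R_cont: "continuous_on D (R k)" for k
    unfolding defs by (auto intro!: continuous_intros run_cont)
  have mem: "run S k z \<in> X \<times> {0..}" if "z \<in> D" for k z
    using budget_stepD(1)[OF run[of k]] that DX by blast
  then have QX: "Q k z \<in> X" and R0: "0 \<le> R k z" if "z \<in> D" for k z
    using that unfolding defs by (auto simp: mem_Times_iff)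
  have Q_near: "dist (Q k z) (fst z) \<le> snd z - R k z"
    and f_drop: "f (Q k z) \<le> f (fst z) - \<kappa> * (snd z - R k z)" if "z \<in> D" for k z
    using budget_stepD(2,3)[OF run[of k], of z] that DX unfolding defs by auto
  have Q_step: "dist (Q (Suc k) z) (Q k z) \<le> R k z - R (Suc k) z" if "z \<in> D" for k z
    using budget_stepD(2)[OF S mem[OF that, of k]] unfolding defs by simp
  have Q_tail: "dist (Q (k + j) z) (Q k z) \<le> R k z - R (k + j) z" if "z \<in> D" for k j z
  proof (induction j)
    case (Suc j)
    with Q_step[OF that, of "k + j"] dist_triangle[of "Q (k + Suc j) z" "Q k z" "Q (k + j) z"]
    show ?case unfolding add_Suc_right by linarith
  qed simp
  have R_dec: "decseq (\<lambda>k. R k z)" if "z \<in> D" for z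
    by (rule decseq_SucI) (use Q_step[OF that] order_trans[OF zero_le_dist] in force)
  have "\<exists>r. (\<lambda>k. R k z) \<longlonglongrightarrow> r" if "z \<in> D" for z
    using decseq_convergent[OF R_dec[OF that], of 0] R0[OF that] by blast
  then obtain \<rho> where \<rho>: "\<And>z. z \<in> D \<Longrightarrow> (\<lambda>k. R k z) \<longlonglongrightarrow> \<rho> z" by metis
  have \<rho>_nonneg: "0 \<le> \<rho> z" if "z \<in> D" for z
    using LIMSEQ_le_const[OF \<rho>[OF that], of 0] R0[OF that] by blast
  have "Cauchy (\<lambda>k. Q k z)" if z: "z \<in> D" for z
  proof (rule metric_CauchyI)
    fix e :: real assume "e > 0"
    then have "\<exists>M. \<forall>k\<ge>M. \<bar>R k z - \<rho> z\<bar> < e / 4"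
      using LIMSEQ_D[OF \<rho>[OF z], of "e / 4"] by simp
    then obtain M where M: "\<And>k. k \<ge> M \<Longrightarrow> \<bar>R k z - \<rho> z\<bar> < e / 4"
      by blast
    have near: "dist (Q k z) (Q M z) < e / 2" if "k \<ge> M" for k
    proof -
      have "dist (Q k z) (Q M z) \<le> R M z - R k z"
        using Q_tail[OF z, of M "k - M"] that by simp
      with M[OF order_refl] M[OF that] show ?thesis by linarith
    qed
    have "dist (Q m z) (Q n z) < e" if "m \<ge> M" "n \<ge> M" for m n
      using dist_triangle2[of "Q m z" "Q n z" "Q M z"] near[OF that(1)] near[OF that(2)] by linarith
    then show "\<exists>M. \<forall>m\<ge>M. \<forall>n\<ge>M. dist (Q m z) (Q n z) < e" by blast
  qed
  then have "\<exists>q. (\<lambda>k. Q k z) \<longlonglongrightarrow> q" if "z \<in> D" for z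
    using that Cauchy_convergent unfolding convergent_def by blast
  then obtain \<Theta> where \<Theta>: "\<And>z. z \<in> D \<Longrightarrow> (\<lambda>k. Q k z) \<longlonglongrightarrow> \<Theta> z" by metis
  have \<Theta>X: "\<Theta> z \<in> X" if "z \<in> D" for z
    using closed_sequentially[OF X _ \<Theta>[OF that]] QX[OF that] by blast
  have \<Theta>_near: "dist (\<Theta> z) (fst z) \<le> snd z" if "z \<in> D" for z
  proof (rule LIMSEQ_le_const2)
    show "(\<lambda>k. dist (Q k z) (fst z)) \<longlonglongrightarrow> dist (\<Theta> z) (fst z)"
      by (intro tendsto_intros \<Theta> that)
    have "dist (Q k z) (fst z) \<le> snd z" for k
      using Q_near[OF that, of k] R0[OF that, of k] by linarith
    then show "\<exists>N. \<forall>k\<ge>N. dist (Q k z) (fst z) \<le> snd z" by blast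
  qed
  have \<rho>_le: "\<rho> z \<le> snd z" if "z \<in> D" for z
  proof (rule LIMSEQ_le_const2[OF \<rho>[OF that]])
    have "R k z \<le> snd z" for k
      using Q_near[OF that, of k] zero_le_dist[of "Q k z" "fst z"] by linarith
    then show "\<exists>N. \<forall>k\<ge>N. R k z \<le> snd z" by blast
  qed
  have exhausted: "\<rho> z = 0" if z: "z \<in> D" for z
  proof (rule ccontr)
    assume "\<rho> z \<noteq> 0"
    with \<rho>_nonneg[OF z] have pos: "\<rho> z > 0" by simp
    with \<rho>_le[OF z] have "snd z \<noteq> 0" by simp
    with z have "X \<inter> cball (fst z) (snd z) \<subseteq> K" unfolding D_def by auto
    with \<Theta>X[OF z] \<Theta>_near[OF z] have "\<Theta> z \<in> X \<inter> K" by (auto simp: dist_commute)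
    with progress pos obtain n where n: "snd (S n (\<Theta> z, \<rho> z)) < \<rho> z" by blast
    have "snd (S n (\<Theta> z, \<rho> z)) = snd (\<Theta> z, \<rho> z)"
    proof (rule run_progress[where A = "X \<times> {0..}" and z = z])
      show "continuous_on (X \<times> {0..}) (S n)"
        using S unfolding budget_step_def by blast
      show "(\<Theta> z, \<rho> z) \<in> X \<times> {0..}"
        using \<Theta>X[OF z] pos by simp
      show "(\<lambda>k. run S k z) \<longlonglongrightarrow> (\<Theta> z, \<rho> z)"
        using tendsto_Pair[OF \<Theta>[OF z] \<rho>[OF z]] unfolding defs by simp
    qed (use mem[OF z] in \<open>auto intro: continuous_intros\<close>)
    with n show False by simp
  qed
  have \<Theta>_tail: "dist (\<Theta> z) (Q k z) \<le> R k z" if z: "z \<in> D" for k z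
  proof (rule LIMSEQ_le_const2)
    show "(\<lambda>j. dist (Q (k + j) z) (Q k z)) \<longlonglongrightarrow> dist (\<Theta> z) (Q k z)"
      using LIMSEQ_ignore_initial_segment[OF \<Theta>[OF z], of k]
      by (intro tendsto_intros) (simp add: add.commute)
    have "dist (Q (k + j) z) (Q k z) \<le> R k z" for j
      using Q_tail[OF z, of k j] R0[OF z, of "k + j"] by linarith
    then show "\<exists>N. \<forall>j\<ge>N. dist (Q (k + j) z) (Q k z) \<le> R k z" by blast
  qed
  \<comment> \<open>Choose \<open>k\<close> so late that little budget is left at \<open>z\<close>. By continuity of the \<open>k\<close>-th iterate the
    same holds near \<open>z\<close>, so there \<open>\<Theta>\<close> differs little from that continuous iterate.\<close>
  have "continuous_on D \<Theta>"
    unfolding continuous_on_iff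
  proof (intro ballI allI impI)
    fix z and e :: real assume z: "z \<in> D" and e: "e > 0"
    have "(\<lambda>k. R k z) \<longlonglongrightarrow> 0" using \<rho>[OF z] exhausted[OF z] by simp
    then have "eventually (\<lambda>k. R k z < e / 6) sequentially"
      using e by (intro order_tendstoD) auto
    then obtain k where k: "R k z < e / 6"
      by (auto simp: eventually_sequentially)
    have e': "0 < e / 3" "0 < e / 6" using e by auto
    from Q_cont[of k, unfolded continuous_on_iff, rule_format, OF z e'(1)]
    obtain d1 where d1: "d1 > 0" "\<And>y. y \<in> D \<Longrightarrow> dist y z < d1 \<Longrightarrow> dist (Q k y) (Q k z) < e / 3"
      by blast
    from R_cont[of k, unfolded continuous_on_iff, rule_format, OF z e'(2)]
    obtain d2 where d2: "d2 > 0" "\<And>y. y \<in> D \<Longrightarrow> dist y z < d2 \<Longrightarrow> dist (R k y) (R k z) < e / 6"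
      by blast
    have "dist (\<Theta> y) (\<Theta> z) < e" if y: "y \<in> D" and "dist y z < min d1 d2" for y
    proof -
      have "dist y z < d2" using that by simp
      from d2(2)[OF y this] k have "R k y < e / 3" unfolding dist_real_def by linarith
      moreover have "dist (Q k y) (Q k z) < e / 3" using d1(2)[OF y] that by simp
      ultimately show ?thesis
        using \<Theta>_tail[OF y, of k] \<Theta>_tail[OF z, of k] k e
          dist_triangle[of "\<Theta> y" "\<Theta> z" "Q k y"] dist_triangle2[of "Q k y" "\<Theta> z" "Q k z"]
        by linarith
    qed
    with d1(1) d2(1) show "\<exists>d>0. \<forall>y\<in>D. dist y z < d \<longrightarrow> dist (\<Theta> y) (\<Theta> z) < e"
      by (intro exI[of _ "min d1 d2"]) auto
  qed
  moreover have "f (\<Theta> z) \<le> f (fst z) - \<kappa> * snd z" if z: "z \<in> D" for z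
  proof (rule LIMSEQ_le)
    show "(\<lambda>k. f (Q k z)) \<longlonglongrightarrow> f (\<Theta> z)"
      using continuous_on_tendsto_compose[OF f \<Theta>[OF z] \<Theta>X[OF z]] QX[OF z] by simp
    have "(\<lambda>k. f (fst z) - \<kappa> * (snd z - R k z)) \<longlonglongrightarrow> f (fst z) - \<kappa> * (snd z - 0)"
      using \<rho>[OF z] exhausted[OF z] by (intro tendsto_intros) simp
    then show "(\<lambda>k. f (fst z) - \<kappa> * (snd z - R k z)) \<longlonglongrightarrow> f (fst z) - \<kappa> * snd z"
      by simp
  qed (use f_drop[OF z] in blast)
  ultimately show ?thesis
    using \<Theta>X \<Theta>_near by (intro exI[of _ \<Theta>]) auto
qed

text \<open>
  Local deformations with one common rate \<open>\<kappa>\<close> integrate to a global flow, even if the radii on which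
  they are defined have no positive lower bound: the cover by these balls is split into countably many
  disjoint families, and each of them supplies one step of the iteration.
\<close>
lemma flow_of_local_descents:
  fixes X :: "'b::complete_space set" and f :: "'b \<Rightarrow> real"
  assumes X: "closed X" and f: "continuous_on X f"
    and loc: "\<And>p. p \<in> K \<Longrightarrow> \<exists>\<rho>>0. \<exists>h. local_descent X f \<kappa> (ball p \<rho>) \<rho> h"
  defines "D \<equiv> {(q, r). q \<in> X \<and> 0 \<le> r \<and> (r = 0 \<or> X \<inter> cball q r \<subseteq> K)}"
  shows "\<exists>\<Theta>. continuous_on D \<Theta> \<and>
           (\<forall>(q, r) \<in> D. \<Theta> (q, r) \<in> X \<and> dist (\<Theta> (q, r)) q \<le> r \<and> f (\<Theta> (q, r)) \<le> f q - \<kappa> * r)"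
proof -
  obtain \<rho> h where \<rho>: "\<And>p. p \<in> K \<Longrightarrow> \<rho> p > 0"
    and h: "\<And>p. p \<in> K \<Longrightarrow> local_descent X f \<kappa> (ball p (\<rho> p)) (\<rho> p) (h p)"
    using loc by metis
  have "\<And>p. p \<in> K \<Longrightarrow> open (ball p (\<rho> p))" by simp
  from sigma_disjoint_open_refinement[of K "\<lambda>p. ball p (\<rho> p)", OF this] obtain V :: "nat \<Rightarrow> 'b \<Rightarrow> 'b set"
    where *: "(\<forall>n. \<forall>p\<in>K. open (V n p) \<and> V n p \<subseteq> ball p (\<rho> p)) \<and>
      (\<forall>n. disjoint_family_on (V n) K) \<and> (\<Union>n. \<Union>p\<in>K. V n p) = (\<Union>p\<in>K. ball p (\<rho> p))"
    by (rule exE)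
  note V = *[THEN conjunct1] and disj = *[THEN conjunct2, THEN conjunct1]
    and cover = *[THEN conjunct2, THEN conjunct2]
  have "local_descent X f \<kappa> (V n p) (\<rho> p) (h p)" if "p \<in> K" for n p
  proof -
    have "(X \<inter> V n p) \<times> {0..\<rho> p} \<subseteq> (X \<inter> ball p (\<rho> p)) \<times> {0..\<rho> p}"
      using V that by blast
    moreover have "continuous_on ((X \<inter> ball p (\<rho> p)) \<times> {0..\<rho> p}) (h p)"
      using h[OF that] unfolding local_descent_def by blast
    ultimately show ?thesis
      using h[OF that] unfolding local_descent_def by (auto intro: continuous_on_subset)
  qed
  then have "\<exists>S. budget_step X f \<kappa> S \<and> (\<forall>q \<in> X \<inter> (\<Union>p\<in>K. V n p). \<forall>r>0. snd (S (q, r)) < r)" for n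
    by (intro glue_local_descents[of K "V n" \<rho> X f \<kappa> h]) (use V disj \<rho> in auto)
  then obtain S where S: "\<And>n. budget_step X f \<kappa> (S n)"
    "\<And>n q r. q \<in> X \<inter> (\<Union>p\<in>K. V n p) \<Longrightarrow> r > 0 \<Longrightarrow> snd (S n (q, r)) < r"
    by metis
  have progress: "\<exists>n. snd (S n (q, r)) < r" if "q \<in> X \<inter> K" "r > 0" for q r
  proof -
    from that \<rho>[of q] have "q \<in> (\<Union>p\<in>K. ball p (\<rho> p))" by force
    with that S(2) show ?thesis unfolding cover[symmetric] by blast
  qed
  show ?thesis
    unfolding D_def by (rule budgeted_flow[OF X f S(1)]) (rule progress)
qed

section \<open>Deforming the graph\<close>

text \<open>
  Some admissible \<open>\<sigma>\<close> exceeds \<open>\<epsilon>\<close>. Slowing its deformation down by the factor \<open>sqrt (1 + \<sigma>\<^sup>2)\<close>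
  gives displacement at most \<open>t\<close> at time \<open>t\<close> and descent at rate
  \<open>\<sigma> / sqrt (1 + \<sigma>\<^sup>2)\<close>, which increases with \<open>\<sigma>\<close>. Hence the rate \<open>\<epsilon> / sqrt (1 + \<epsilon>\<^sup>2)\<close> serves all points whose weak slope exceeds \<open>\<epsilon>\<close>.
\<close>
lemma weak_slope_local_descent:
  assumes "weak_slope F p > ennreal \<epsilon>" and "\<epsilon> > 0"
  shows "\<exists>\<rho>>0. \<exists>h. local_descent (mgraph F) snd (\<epsilon> / sqrt (1 + \<epsilon>\<^sup>2)) (ball p \<rho>) \<rho> h"
proof -
  obtain \<sigma> where \<sigma>: "0 \<le> \<sigma>" "slope_admissible F p \<sigma>" "ennreal \<epsilon> < ennreal \<sigma>"
    using assms(1) unfolding weak_slope_def less_SUP_iff by auto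
  then have "\<epsilon> < \<sigma>" using assms(2) by (simp add: ennreal_less_iff)
  define s where "s = sqrt (1 + \<sigma>\<^sup>2)"
  have s: "s \<ge> 1" unfolding s_def by simp
  obtain \<rho> H where \<rho>: "\<rho> > 0" and H_cont: "continuous_on (gball F p \<rho> \<times> {0..\<rho>}) H"
    and HX: "H ` (gball F p \<rho> \<times> {0..\<rho>}) \<subseteq> mgraph F"
    and H: "\<And>q t. q \<in> gball F p \<rho> \<Longrightarrow> t \<in> {0..\<rho>} \<Longrightarrow>
       dist (H (q, t)) q \<le> t * s \<and> snd (H (q, t)) \<le> snd q - \<sigma> * t"
    using \<sigma>(2) unfolding slope_admissible_def s_def by blast
  have rate: "\<epsilon> / sqrt (1 + \<epsilon>\<^sup>2) \<le> \<sigma> / s"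
  proof -
    have "\<epsilon>\<^sup>2 \<le> \<sigma>\<^sup>2" using \<open>\<epsilon> < \<sigma>\<close> assms(2) by (simp add: power_mono)
    then have "(\<epsilon> * s)\<^sup>2 \<le> (\<sigma> * sqrt (1 + \<epsilon>\<^sup>2))\<^sup>2"
      unfolding s_def power_mult_distrib by (simp add: algebra_simps)
    then have "\<epsilon> * s \<le> \<sigma> * sqrt (1 + \<epsilon>\<^sup>2)"
      by (rule power2_le_imp_le) (use \<sigma>(1) in simp)
    moreover have "sqrt (1 + \<epsilon>\<^sup>2) > 0" by (simp add: add_pos_nonneg)
    ultimately show ?thesis using s by (simp add: divide_simps mult.commute)
  qed
  have ball: "mgraph F \<inter> ball p \<rho> = gball F p \<rho>"
    unfolding gball_def by blast
  have t_s: "t / s \<in> {0..\<rho>}" if "t \<in> {0..\<rho>}" for t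
  proof -
    have "t / s \<le> t / 1" using s that by (intro divide_left_mono) auto
    with s that show ?thesis by auto
  qed
  have "local_descent (mgraph F) snd (\<epsilon> / sqrt (1 + \<epsilon>\<^sup>2)) (ball p \<rho>) \<rho> (\<lambda>(q, t). H (q, t / s))"
    unfolding local_descent_def ball
  proof (intro conjI ballI)
    show "continuous_on (gball F p \<rho> \<times> {0..\<rho>}) (\<lambda>(q, t). H (q, t / s))"
      unfolding case_prod_unfold
      by (rule continuous_on_compose2[OF H_cont]) (use s t_s in \<open>auto intro!: continuous_intros\<close>)
    show "(\<lambda>(q, t). H (q, t / s)) ` (gball F p \<rho> \<times> {0..\<rho>}) \<subseteq> mgraph F"
      using HX t_s by fastforce
    fix q t assume q: "q \<in> gball F p \<rho>" and t: "t \<in> {0..\<rho>}"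
    show "dist (case (q, t) of (q, t) \<Rightarrow> H (q, t / s)) q \<le> t"
      using H[OF q t_s[OF t]] s by simp
    have "\<epsilon> / sqrt (1 + \<epsilon>\<^sup>2) * t \<le> \<sigma> / s * t"
      using rate t by (intro mult_right_mono) auto
    then show "snd (case (q, t) of (q, t) \<Rightarrow> H (q, t / s)) \<le> snd q - \<epsilon> / sqrt (1 + \<epsilon>\<^sup>2) * t"
      using H[OF q t_s[OF t]] by simp
  qed
  with \<rho> show ?thesis by blast
qed

theorem theorem3p1:
  fixes F :: "'a::complete_space \<Rightarrow> ereal set"
    and U :: "('a \<times> real) set"
    and c l \<epsilon>0 \<delta> :: real
  assumes "multivalued F"
    and "closed (mgraph F)"
    and "closedin (top_of_set (mgraph F)) U"
    and "l > 0"
    and "\<epsilon>0 > 0"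
    and "\<delta> > 0"
    and "\<forall>p \<in> strip c (2 * \<epsilon>0) \<inter> gnbhd F U (2 * \<delta>). weak_slope F p > ennreal \<epsilon>0"
  shows "\<exists>\<eta> :: real \<times> ('a \<times> real) \<Rightarrow> 'a \<times> real.
      continuous_on ({0..1} \<times> mgraph F) \<eta> \<and>
      \<eta> ` ({0..1} \<times> mgraph F) \<subseteq> mgraph F \<and>
      (\<forall>t \<in> {0..1}. \<forall>p \<in> mgraph F. dist (\<eta> (t, p)) p \<le> l * t) \<and>
      (\<forall>t \<in> {0..1}. \<forall>p \<in> mgraph F. snd (\<eta> (t, p)) \<le> snd p) \<and>
      (\<forall>p \<in> mgraph F. p \<notin> strip c (2 * \<epsilon>0) \<inter> gnbhd F U (2 * \<delta>) \<longrightarrow>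
         (\<forall>t \<in> {0..1}. \<eta> (t, p) = p)) \<and>
      (\<exists>\<epsilon>' \<in> {0<..<\<epsilon>0}.
         (\<lambda>p. \<eta> (1, p)) ` (U \<inter> (UNIV \<times> {..c + \<epsilon>'})) \<subseteq> UNIV \<times> {..c - \<epsilon>'}) \<and>
      (\<forall>t \<in> {0<..1}. \<forall>p \<in> (UNIV \<times> {..c}) \<inter> U. snd (\<eta> (t, p)) < c)"
proof (cases "U = {}")
  case True
  \<comment> \<open>No point may move in this case, and the map \<open>snd\<close> sends \<open>(t, p)\<close> to \<open>p\<close>.\<close>
  have "gnbhd F U (2 * \<delta>) = {}" unfolding gnbhd_def True by simp
  with True assms(4,5) show ?thesis
    by (intro exI[of _ snd])
      (auto intro!: continuous_intros exI[of _ "\<epsilon>0 / 2"])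
next
  case False
  define K where "K = strip c (2 * \<epsilon>0) \<inter> gnbhd F U (2 * \<delta>)"
  define \<kappa> where "\<kappa> = \<epsilon>0 / sqrt (1 + \<epsilon>0\<^sup>2)"
  have \<kappa>: "\<kappa> > 0" using assms(5) unfolding \<kappa>_def by (simp add: add_pos_nonneg)
  have UX: "U \<subseteq> mgraph F" using assms(3) closedin_imp_subset by fastforce
  have snd_lip: "\<bar>snd q - snd p\<bar> \<le> dist q p" for p q :: "'a \<times> real"
    using dist_snd_le[of q p] by (simp add: dist_real_def)
  define D where "D = {(q, r). q \<in> mgraph F \<and> (0::real) \<le> r \<and> (r = 0 \<or> mgraph F \<inter> cball q r \<subseteq> K)}"
  have "\<exists>\<Theta>. continuous_on D \<Theta> \<and> (\<forall>(q, r) \<in> D. \<Theta> (q, r) \<in> mgraph F \<and>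
      dist (\<Theta> (q, r)) q \<le> r \<and> snd (\<Theta> (q, r)) \<le> snd q - \<kappa> * r)"
    unfolding D_def
  proof (rule flow_of_local_descents)
    show "continuous_on (mgraph F) snd" by (intro continuous_intros)
    show "\<exists>\<rho>>0. \<exists>h. local_descent (mgraph F) snd \<kappa> (ball p \<rho>) \<rho> h" if "p \<in> K" for p
      unfolding \<kappa>_def by (rule weak_slope_local_descent) (use that assms(5,7) in \<open>auto simp: K_def\<close>)
  qed (rule assms(2))
  then obtain \<Theta> where \<Theta>_cont: "continuous_on D \<Theta>"
    and \<Theta>: "\<And>q r. (q, r) \<in> D \<Longrightarrow> \<Theta> (q, r) \<in> mgraph F \<and>
      dist (\<Theta> (q, r)) q \<le> r \<and> snd (\<Theta> (q, r)) \<le> snd q - \<kappa> * r"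
    by blast
  \<comment> \<open>Halving the two margins ensures that no point of the graph within distance \<open>g p\<close> of \<open>p\<close>
    lies outside \<open>K\<close> if \<open>g p > 0\<close>, since
    both the distance to \<open>U\<close> and the height are 1-Lipschitz.\<close>
  define g where "g p = min l (min (max 0 ((2 * \<delta> - infdist p U) / 2))
      (max 0 ((2 * \<epsilon>0 - \<bar>snd p - c\<bar>) / 2)))" for p :: "'a \<times> real"
  have g_cont: "continuous_on A g" for A
    unfolding g_def by (intro continuous_intros) auto
  have g_nonneg: "0 \<le> g p" and g_le: "g p \<le> l" for p
    using assms(4) unfolding g_def by auto
  have g_0: "g p = 0" if "p \<in> mgraph F" "p \<notin> K" for p
  proof -
    have "\<not> infdist p U \<le> 2 * \<delta> \<or> \<not> \<bar>snd p - c\<bar> \<le> 2 * \<epsilon>0"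
      using that False unfolding K_def strip_def gnbhd_def by (auto simp: mem_Times_iff)
    then show ?thesis using assms(4) unfolding g_def by auto
  qed
  have inside: "mgraph F \<inter> cball p r \<subseteq> K" if "r \<noteq> 0" "0 \<le> r" "r \<le> g p" for p r
  proof
    fix q assume q: "q \<in> mgraph F \<inter> cball p r"
    have "infdist q U \<le> infdist p U + dist q p"
      by (rule infdist_triangle)
    moreover have "dist q p \<le> (2 * \<delta> - infdist p U) / 2" "dist q p \<le> (2 * \<epsilon>0 - \<bar>snd p - c\<bar>) / 2"
      using q that unfolding g_def by (auto simp: dist_commute max_def split: if_splits)
    moreover have "\<bar>snd q - c\<bar> \<le> \<bar>snd p - c\<bar> + dist q p"
      using snd_lip[of q p] by linarith
    ultimately have "infdist q U \<le> 2 * \<delta>" "\<bar>snd q - c\<bar> \<le> 2 * \<epsilon>0"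
      using zero_le_dist[of q p] by argo+
    then show "q \<in> K"
      using q False unfolding K_def strip_def gnbhd_def by (auto simp: mem_Times_iff)
  qed
  have in_D: "(p, t * g p) \<in> D" if "p \<in> mgraph F" "t \<in> {0..1}" for p t
  proof -
    have "t * g p \<le> g p" using that g_nonneg[of p] by (simp add: mult_left_le_one_le)
    with that g_nonneg[of p] inside[of "t * g p" p] show ?thesis unfolding D_def by auto
  qed
  define \<eta> where "\<eta> z = \<Theta> (snd z, fst z * g (snd z))" for z
  have \<eta>: "\<eta> (t, p) \<in> mgraph F" "dist (\<eta> (t, p)) p \<le> t * g p" "snd (\<eta> (t, p)) \<le> snd p - \<kappa> * (t * g p)"
    if "t \<in> {0..1}" "p \<in> mgraph F" for t p
    using \<Theta>[OF in_D[OF that(2,1)]] unfolding \<eta>_def by auto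
  have \<eta>_cont: "continuous_on ({0..1} \<times> mgraph F) \<eta>"
    unfolding \<eta>_def
    by (rule continuous_on_compose2[OF \<Theta>_cont])
      (auto intro!: continuous_intros continuous_on_compose2[OF g_cont[of UNIV]] in_D)
  have \<eta>_dist: "dist (\<eta> (t, p)) p \<le> l * t" if "t \<in> {0..1}" "p \<in> mgraph F" for t p
    using \<eta>(2)[OF that] mult_left_mono[OF g_le[of p], of t] that by (simp add: mult.commute)
  have \<eta>_mono: "snd (\<eta> (t, p)) \<le> snd p" if "t \<in> {0..1}" "p \<in> mgraph F" for t p
  proof -
    have "0 \<le> \<kappa> * (t * g p)" using \<kappa> that g_nonneg[of p] by simp
    with \<eta>(3)[OF that] show ?thesis by linarith
  qed
  have \<eta>_fixed: "\<eta> (t, p) = p" if "p \<in> mgraph F" "p \<notin> K" "t \<in> {0..1}" for t p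
    using \<eta>(2)[OF that(3,1)] g_0[OF that(1,2)] by simp
  \<comment> \<open>The value of the budget \<open>g\<close> at points of \<open>U\<close> at height \<open>c + \<epsilon>0\<close> or \<open>c - \<epsilon>0\<close>.\<close>
  define m where "m = min l (min \<delta> (\<epsilon>0 / 2))"
  have m: "m > 0" using assms(4-6) unfolding m_def by simp
  have g_ge: "m \<le> g p" if "p \<in> U" "\<bar>snd p - c\<bar> \<le> \<epsilon>0" for p
    using that unfolding g_def m_def by (auto simp: min_def max_def)
  \<comment> \<open>A descent by \<open>\<kappa> * m\<close> must cross the band from \<open>c + \<epsilon>'\<close> to \<open>c - \<epsilon>'\<close>, and this band must lie
    where \<open>g\<close> is at least \<open>m\<close>.\<close>
  define \<epsilon>' where "\<epsilon>' = min \<epsilon>0 (\<kappa> * m) / 2"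
  have "\<kappa> * m > 0" using \<kappa> m by simp
  then have \<epsilon>': "0 < \<epsilon>'" "\<epsilon>' < \<epsilon>0" "2 * \<epsilon>' \<le> \<kappa> * m"
    using assms(5) unfolding \<epsilon>'_def by auto
  have deep: "snd (\<eta> (1, p)) \<le> c - \<epsilon>'" if p: "p \<in> U" "snd p \<le> c + \<epsilon>'" for p
  proof (cases "snd p \<le> c - \<epsilon>'")
    case True
    with \<eta>_mono[of 1 p] p UX show ?thesis by fastforce
  next
    case False
    with p \<epsilon>' have "m \<le> g p" by (intro g_ge) auto
    then have "\<kappa> * m \<le> \<kappa> * g p" using \<kappa> by simp
    with \<eta>(3)[of 1 p] p UX \<epsilon>' show ?thesis by auto
  qed
  have strict: "snd (\<eta> (t, p)) < c" if p: "p \<in> U" "snd p \<le> c" and t: "t \<in> {0<..1}" for t p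
  proof (cases "snd p < c")
    case True
    with \<eta>_mono[of t p] p t UX show ?thesis by fastforce
  next
    case False
    with p assms(5) m have "0 < g p" using g_ge[of p] by auto
    with \<kappa> t have "0 < \<kappa> * (t * g p)" by simp
    with \<eta>(3)[of t p] p t UX show ?thesis by fastforce
  qed
  show ?thesis
    unfolding K_def[symmetric]
    by (intro exI[of _ \<eta>] conjI bexI[of _ \<epsilon>'])
      (use \<eta>_cont \<eta>(1) \<eta>_dist \<eta>_mono \<eta>_fixed deep strict \<epsilon>' in \<open>auto simp: image_subset_iff mem_Times_iff\<close>)
qed

end
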